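(* Let $m\ge 2$ be an integer. The function $\pi_1\colon \mathbb{N}_{\ge 1}^m\to[0,1]$, $$\pi_1(n_1,\ldots,n_m)=\mathbb{P}(A_2\le n_2-1,\ldots,A_m\le n_m-1),$$ where $(A_2,\ldots,A_m)$ has a negative multinomial distribution with parameters $(n_1;p_2,\ldots,p_m)$ and $p_\ell=\frac{n_\ell}{n_1+\cdots+n_m}$ for $\ell\in\{2,\ldots,m\}$, is increasing in each of the variables $n_2,\ldots,n_m$.
   Context: For $n_1\in\mathbb{N}_{\ge1}$ and $p_2,\ldots,p_m\in(0,1)$ with $p_1:=1-\sum_{k=2}^m p_k>0$, the random vector $(A_2,\ldots,A_m)$ has a negative multinomial distribution with parameters $(n_1;p_2,\ldots,p_m)$ if for all integers $k_2,\ldots,k_m\ge 0$ $$\mathbb{P}(A_2=k_2,\ldots,A_m=k_m)=\frac{(n_1+k_2+\cdots+k_m-1)!}{(n_1-1)!\,k_2!\cdots k_m!}\,p_1^{n_1}\prod_{\ell=2}^m p_\ell^{k_\ell}.$$ Interpretation: $\pi_1(n_1,\ldots,n_m)$ is the probability that player 1 wins the $m$-player game in which in each round, independently, exactly one player advances by one step, namely player $\ell$ with probability $n_\ell/(n_1+\cdots+n_m)$, and the first player $\ell$ to have made $n_\ell$ steps wins. When one $n_k$ is varied, all the probabilities $p_\ell=n_\ell/(n_1+\cdots+n_m)$ vary accordingly. *)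

theory Defs
  imports "HOL-Probability.Probability"
begin

text \<open>
  A vector indexed by a finite set \<open>I\<close> is represented by a function on \<open>nat\<close> that vanishes
  outside \<open>I\<close>.
\<close>

definition count_vectors :: "nat set \<Rightarrow> (nat \<Rightarrow> nat) set" where
  "count_vectors I = {k. \<forall>l. l \<notin> I \<longrightarrow> k l = 0}"

text \<open>
  The parameters are meaningful for \<open>r \<ge> 1\<close>, \<open>p l \<in> {0<..<1}\<close> for \<open>l \<in> I\<close> and \<open>sum p I < 1\<close>;
  the remaining mass \<open>1 - sum p I\<close> is the probability written \<open>p\<^sub>1\<close> when \<open>I = {2..m}\<close>.
\<close>

definition negative_multinomial_mass ::
    "nat set \<Rightarrow> nat \<Rightarrow> (nat \<Rightarrow> real) \<Rightarrow> (nat \<Rightarrow> nat) \<Rightarrow> real" where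
  "negative_multinomial_mass I r p k =
     fact (r + (\<Sum>l\<in>I. k l) - 1) / (fact (r - 1) * (\<Prod>l\<in>I. fact (k l)))
       * (1 - (\<Sum>l\<in>I. p l)) ^ r * (\<Prod>l\<in>I. p l ^ k l)"

definition negative_multinomial_pmf ::
    "nat set \<Rightarrow> nat \<Rightarrow> (nat \<Rightarrow> real) \<Rightarrow> (nat \<Rightarrow> nat) pmf" where
  "negative_multinomial_pmf I r p =
     embed_pmf (\<lambda>k. if k \<in> count_vectors I then negative_multinomial_mass I r p k else 0)"

definition win_prob :: "nat \<Rightarrow> (nat \<Rightarrow> nat) \<Rightarrow> real" where
  "win_prob m n =
     measure_pmf.prob
       (negative_multinomial_pmf {2..m} (n 1) (\<lambda>l. real (n l) / real (\<Sum>j=1..m. n j)))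
       {A. \<forall>l\<in>{2..m}. A l \<le> n l - 1}"

text \<open>
  The masses sum to one, so that \<^const>\<open>embed_pmf\<close> above does yield the distribution with
  the given point masses.
\<close>

lemma nn_integral_negative_binomial_series:
  fixes q :: real
  assumes "0 < q" "q < 1"
  shows "(\<integral>\<^sup>+ a. ennreal (real ((a + R - 1) choose a) * q ^ a) \<partial>count_space UNIV)
           = ennreal ((1 / (1 - q)) ^ R)"
proof -
  let ?P = "neg_binomial_pmf R (1 - q)"
  have "real ((a + R - 1) choose a) * q ^ a = (1 / (1 - q)) ^ R * pmf ?P a" for a
    using assms by (subst pmf_neg_binomial) (auto simp: field_simps)
  then have "(\<integral>\<^sup>+ a. ennreal (real ((a + R - 1) choose a) * q ^ a) \<partial>count_space UNIV)
      = (\<integral>\<^sup>+ a. ennreal ((1 / (1 - q)) ^ R) * ennreal (pmf ?P a) \<partial>count_space UNIV)"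
    using assms by (intro nn_integral_cong) (simp add: ennreal_mult)
  also have "\<dots> = ennreal ((1 / (1 - q)) ^ R) * (\<integral>\<^sup>+ a. ennreal (pmf ?P a) \<partial>count_space UNIV)"
    by (rule nn_integral_cmult) simp
  also have "(\<integral>\<^sup>+ a. ennreal (pmf ?P a) \<partial>count_space UNIV) = 1"
    by (simp add: nn_integral_pmf measure_pmf.emeasure_space_1[simplified])
  finally show ?thesis by simp
qed

lemma bij_betw_count_vectors_insert:
  assumes "j \<notin> I"
  shows "bij_betw (\<lambda>(k, a). k(j := a)) (count_vectors I \<times> UNIV) (count_vectors (insert j I))"
proof (rule bij_betwI[where g = "\<lambda>k. (k(j := 0), k j)"])
  show "(\<lambda>(k, a). k(j := a)) \<in> count_vectors I \<times> UNIV \<rightarrow> count_vectors (insert j I)"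
    by (auto simp: count_vectors_def)
  show "(\<lambda>k. (k(j := 0), k j)) \<in> count_vectors (insert j I) \<rightarrow> count_vectors I \<times> UNIV"
    by (auto simp: count_vectors_def)
qed (use assms in \<open>auto simp: count_vectors_def fun_eq_iff\<close>)

lemma nn_integral_negative_multinomial_series:
  fixes p :: "nat \<Rightarrow> real"
  assumes "finite I" "r \<ge> 1" "\<And>l. l \<in> I \<Longrightarrow> 0 < p l" "sum p I < 1"
  shows "(\<integral>\<^sup>+ k. ennreal (fact (r + sum k I - 1) / (fact (r - 1) * (\<Prod>l\<in>I. fact (k l)))
              * (\<Prod>l\<in>I. p l ^ k l)) \<partial>count_space (count_vectors I))
           = ennreal ((1 / (1 - sum p I)) ^ r)"
  using assms(1,3,4)
proof (induction I arbitrary: p rule: finite_induct)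
  case empty
  have "count_vectors {} = {\<lambda>_. 0}" by (auto simp: count_vectors_def)
  then show ?case by (simp add: nn_integral_count_space_finite)
next
  case (insert j I)
  define w where "w = (\<lambda>I (p :: nat \<Rightarrow> real) (k :: nat \<Rightarrow> nat).
    fact (r + sum k I - 1) / (fact (r - 1) * (\<Prod>l\<in>I. fact (k l))) * (\<Prod>l\<in>I. p l ^ k l))"
  define q where "q = p j"
  define p' where "p' = (\<lambda>l. p l / (1 - q))"
  have pos: "0 < p l" if "l \<in> I" for l using insert that by auto
  have sI: "q + sum p I < 1" using insert by (simp add: q_def)
  have "0 \<le> sum p I" using pos by (intro sum_nonneg) (auto intro: less_imp_le)
  then have q: "0 < q" "q < 1" using insert sI by (auto simp: q_def)
  have sp': "sum p' I = sum p I / (1 - q)" by (simp add: p'_def sum_divide_distrib)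
  have w_nonneg: "0 \<le> w I p k" for k
    unfolding w_def using pos
    by (intro mult_nonneg_nonneg divide_nonneg_nonneg prod_nonneg) (auto intro: less_imp_le)
  have w'_nonneg: "0 \<le> w I p' k" for k
    unfolding w_def p'_def using pos q
    by (intro mult_nonneg_nonneg divide_nonneg_nonneg prod_nonneg) (auto intro: less_imp_le)
  have step: "w (insert j I) p (k(j := a))
      = w I p k * (real ((a + (r + sum k I) - 1) choose a) * q ^ a)" for k a
  proof -
    let ?s = "r + sum k I"
    have s1: "sum (k(j := a)) (insert j I) = a + sum k I"
      using insert by (subst sum.insert) (auto intro!: sum.cong)
    have pr1: "(\<Prod>l\<in>insert j I. fact ((k(j := a)) l) :: real) = fact a * (\<Prod>l\<in>I. fact (k l))"
      using insert by (subst prod.insert) (auto intro!: prod.cong)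
    have "(\<Prod>l\<in>I. p l ^ (k(j := a)) l) = (\<Prod>l\<in>I. p l ^ k l)"
      using insert.hyps by (intro prod.cong) auto
    then have pr2: "(\<Prod>l\<in>insert j I. p l ^ (k(j := a)) l) = q ^ a * (\<Prod>l\<in>I. p l ^ k l)"
      using insert.hyps by (simp add: q_def)
    have e: "a + ?s - 1 - a = ?s - 1" by simp
    have "a \<le> a + ?s - 1" using \<open>r \<ge> 1\<close> by simp
    then have b: "real ((a + ?s - 1) choose a) = fact (a + ?s - 1) / (fact a * fact (?s - 1))"
      by (simp only: binomial_fact e)
    have e2: "r + (a + sum k I) - 1 = a + ?s - 1" by simp
    have ne: "(\<Prod>l\<in>I. fact (k l) :: real) \<noteq> 0" using insert by simp
    show ?thesis
      unfolding w_def s1 pr1 pr2 b e2 using ne by (simp add: field_simps)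
  qed
  have scale: "w I p k * (1 / (1 - q)) ^ (r + sum k I) = (1 / (1 - q)) ^ r * w I p' k" for k
  proof -
    have "(\<Prod>l\<in>I. p' l ^ k l) = (\<Prod>l\<in>I. p l ^ k l) * (1 / (1 - q)) ^ sum k I"
      by (simp add: p'_def power_divide prod_dividef power_sum)
    then show ?thesis by (simp add: w_def power_add)
  qed
  have inner: "(\<integral>\<^sup>+ a. ennreal (w (insert j I) p (k(j := a))) \<partial>count_space UNIV)
      = ennreal ((1 / (1 - q)) ^ r) * ennreal (w I p' k)" for k
  proof -
    have "(\<integral>\<^sup>+ a. ennreal (w (insert j I) p (k(j := a))) \<partial>count_space UNIV)
        = (\<integral>\<^sup>+ a. ennreal (w I p k) *
             ennreal (real ((a + (r + sum k I) - 1) choose a) * q ^ a) \<partial>count_space UNIV)"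
      unfolding step using w_nonneg q by (intro nn_integral_cong ennreal_mult) auto
    also have "\<dots> = ennreal (w I p k) * ennreal ((1 / (1 - q)) ^ (r + sum k I))"
      by (subst nn_integral_cmult) (simp_all only: nn_integral_negative_binomial_series[OF q], simp)
    also have "\<dots> = ennreal ((1 / (1 - q)) ^ r * w I p' k)"
      unfolding scale[symmetric] using w_nonneg q by (intro ennreal_mult[symmetric]) auto
    also have "\<dots> = ennreal ((1 / (1 - q)) ^ r) * ennreal (w I p' k)"
      using w'_nonneg q by (intro ennreal_mult) auto
    finally show ?thesis .
  qed
  have "(\<integral>\<^sup>+ k. ennreal (w (insert j I) p k) \<partial>count_space (count_vectors (insert j I)))
      = (\<integral>\<^sup>+ x. ennreal (w (insert j I) p ((\<lambda>(k, a). k(j := a)) x))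
           \<partial>count_space (count_vectors I \<times> UNIV))"
    by (rule nn_integral_bij_count_space[symmetric, OF bij_betw_count_vectors_insert[OF insert(2)]])
  also have "\<dots> = (\<integral>\<^sup>+ x. ennreal (w (insert j I) p ((fst x)(j := snd x)))
           * indicator (count_vectors I \<times> UNIV) x \<partial>count_space UNIV)"
    by (subst nn_integral_count_space_indicator) (auto simp: case_prod_unfold)
  also have "\<dots> = (\<integral>\<^sup>+ k. \<integral>\<^sup>+ a. ennreal (w (insert j I) p (k(j := a)))
           * indicator (count_vectors I) k \<partial>count_space UNIV \<partial>count_space UNIV)"
    by (subst nn_integral_fst_count_space[symmetric]) (simp add: indicator_times)
  also have "\<dots> = (\<integral>\<^sup>+ k. ennreal ((1 / (1 - q)) ^ r) *
           (ennreal (w I p' k) * indicator (count_vectors I) k) \<partial>count_space UNIV)"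
    by (intro nn_integral_cong) (subst nn_integral_multc, simp, simp only: inner mult.assoc)
  also have "\<dots> = ennreal ((1 / (1 - q)) ^ r) *
           (\<integral>\<^sup>+ k. ennreal (w I p' k) \<partial>count_space (count_vectors I))"
    by (subst nn_integral_cmult) (auto simp: nn_integral_count_space_indicator)
  also have "(\<integral>\<^sup>+ k. ennreal (w I p' k) \<partial>count_space (count_vectors I))
      = ennreal ((1 / (1 - sum p' I)) ^ r)"
    unfolding w_def by (rule insert.IH) (use pos q sI in \<open>auto simp: p'_def sp'[unfolded p'_def]\<close>)
  also have "ennreal ((1 / (1 - q)) ^ r) * \<dots> = ennreal ((1 / (1 - q)) ^ r * (1 / (1 - sum p' I)) ^ r)"
    using q by (intro ennreal_mult'[symmetric]) auto
  also have "(1 / (1 - q)) ^ r * (1 / (1 - sum p' I)) ^ r = (1 / (1 - sum p (insert j I))) ^ r"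
  proof -
    have "(1 / (1 - q)) * (1 / (1 - sum p' I)) = 1 / (1 - sum p (insert j I))"
      using insert q sI by (simp add: sp' q_def[symmetric] field_simps)
    then show ?thesis by (metis power_mult_distrib)
  qed
  finally show ?case unfolding w_def .
qed

lemma pmf_negative_multinomial:
  fixes p :: "nat \<Rightarrow> real"
  assumes "finite I" "r \<ge> 1" "\<And>l. l \<in> I \<Longrightarrow> 0 < p l" "sum p I < 1"
  shows "pmf (negative_multinomial_pmf I r p) k =
           (if k \<in> count_vectors I then negative_multinomial_mass I r p k else 0)"
proof -
  define c where "c = (1 - sum p I) ^ r"
  define w where "w = (\<lambda>k. fact (r + sum k I - 1) / (fact (r - 1) * (\<Prod>l\<in>I. fact (k l)))
              * (\<Prod>l\<in>I. p l ^ k l))"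
  have c: "0 < c" using assms by (simp add: c_def)
  have w_nonneg: "0 \<le> w k" for k
    unfolding w_def using assms(3)
    by (intro mult_nonneg_nonneg divide_nonneg_nonneg prod_nonneg) (auto intro: less_imp_le)
  have mass: "negative_multinomial_mass I r p k = c * w k" for k
    by (simp add: negative_multinomial_mass_def c_def w_def)
  have "(\<integral>\<^sup>+ k. ennreal (if k \<in> count_vectors I then c * w k else 0) \<partial>count_space UNIV)
      = (\<integral>\<^sup>+ k. ennreal c * (ennreal (w k) * indicator (count_vectors I) k) \<partial>count_space UNIV)"
    using c w_nonneg by (intro nn_integral_cong) (auto simp: ennreal_mult indicator_def)
  also have "\<dots> = ennreal c * (\<integral>\<^sup>+ k. ennreal (w k) \<partial>count_space (count_vectors I))"
    by (subst nn_integral_cmult) (auto simp: nn_integral_count_space_indicator)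
  also have "\<dots> = ennreal c * ennreal ((1 / (1 - sum p I)) ^ r)"
    unfolding w_def using nn_integral_negative_multinomial_series[OF assms] by simp
  also have "\<dots> = 1"
    using c assms(4) by (simp add: c_def power_divide flip: ennreal_mult'')
  finally have "(\<integral>\<^sup>+ k. ennreal (if k \<in> count_vectors I then c * w k else 0) \<partial>count_space UNIV) = 1" .
  then show ?thesis
    unfolding negative_multinomial_pmf_def mass using c w_nonneg
    by (intro pmf_embed_pmf) auto
qed

end

theory Submission
  imports Defs
begin

text \<open>
  Let the steps of player \<open>l\<close> occur along independent Poisson processes of rate \<open>n l\<close>. The
  finishing times are then independent Erlang variables of mean \<open>1\<close>, and the winning probability
  of player \<open>1\<close> is the integral of the Erlang density of player \<open>1\<close> against the product of the
  survival functions \<open>G\<^sub>n(t)\<close> of the others. The difference \<open>D = G\<^sub>n\<^sub>+\<^sub>1 - G\<^sub>n\<close> changes sign once,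
  from plus to minus, and the product of the remaining survival functions is decreasing; replacing
  it by its value at the sign change can only lower the integral. This reduces the claim to two
  players. There the integral is an explicit finite sum \<open>R\<^sub>n(u)\<close> in \<open>n\<close> and the rate \<open>u\<close>
  of the opponent, and the \<open>u\<close>-derivative of \<open>R\<^sub>n\<^sub>+\<^sub>1\<close> telescopes to a constant multiple of
  \<open>u ^ n / (r + u) ^ (n + r + 1)\<close>. The mean value theorem on \<open>[n, n + 1]\<close> then compares the loss
  from raising the rate with the gain from the additional step.
\<close>

section \<open>Integrals against Erlang densities\<close>

lemma has_bochner_integral_erlang_density:
  assumes "0 < l"
  shows "has_bochner_integral lborel (erlang_density k l) 1"
  using assms nn_integral_erlang_ith_moment[OF assms, where k = k and i = 0]
  by (intro has_bochner_integral_nn_integral) auto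

text \<open>Up to a constant factor the integrand is again an Erlang density, with shape raised by
  \<open>j\<close> and rate raised by \<open>b\<close>; the factor is the integral.\<close>

lemma has_bochner_integral_erlang_power_exp:
  assumes "0 < l" "0 \<le> b"
  shows "has_bochner_integral lborel (\<lambda>t. erlang_density k l t * (t ^ j * exp (- (b * t))))
           (fact (k + j) / fact k * l ^ Suc k / (l + b) ^ Suc (k + j))"
proof -
  define c where "c = fact (k + j) / fact k * l ^ Suc k / (l + b) ^ Suc (k + j)"
  have "(l + b) ^ Suc (k + j) \<noteq> 0" using assms by auto
  then have "erlang_density k l t * (t ^ j * exp (- (b * t)))
      = c * erlang_density (k + j) (l + b) t" for t
    by (simp add: erlang_density_def c_def power_add ring_distribs exp_add[symmetric] del: power_Suc)
  moreover have "has_bochner_integral lborel (\<lambda>t. c * erlang_density (k + j) (l + b) t) (c * 1)"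
    using assms by (intro has_bochner_integral_mult_right has_bochner_integral_erlang_density) auto
  ultimately show ?thesis by (simp add: c_def)
qed

text \<open>
  In contrast to \<^const>\<open>erlang_density\<close>, whose shape is offset by one, \<open>n\<close> is here the number of
  steps to be made, so that \<open>erlang_tail (Suc n)\<close> belongs to \<open>erlang_density n\<close>.
\<close>

definition erlang_tail :: "nat \<Rightarrow> real \<Rightarrow> real \<Rightarrow> real" where
  "erlang_tail n l t = (\<Sum>j<n. (l * t) ^ j / fact j * exp (- (l * t)))"

text \<open>Multiplying out the product gives one term for each choice \<open>g\<close> of the
  opponents' step counts, a power times an exponential. Once the rates are divided by
  \<open>r + sum u I\<close>, the integrated terms are negative multinomial masses.\<close>

lemma has_bochner_integral_erlang_tail_prod:
  assumes "finite I" "0 < r" "\<And>i. i \<in> I \<Longrightarrow> 0 \<le> u i"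
  shows "has_bochner_integral lborel
           (\<lambda>t. erlang_density k r t * (\<Prod>i\<in>I. erlang_tail (n i) (u i) t))
           (\<Sum>g\<in>PiE I (\<lambda>i. {..<n i}). fact (k + sum g I) / (fact k * (\<Prod>i\<in>I. fact (g i)))
              * r ^ Suc k * (\<Prod>i\<in>I. u i ^ g i) / (r + sum u I) ^ Suc (k + sum g I))"
proof -
  define c where "c = (\<lambda>g. (\<Prod>i\<in>I. u i ^ g i / fact (g i)))"
  have "(\<Prod>i\<in>I. erlang_tail (n i) (u i) t)
      = (\<Sum>g\<in>PiE I (\<lambda>i. {..<n i}). c g * (t ^ sum g I * exp (- (sum u I * t))))" for t
    unfolding erlang_tail_def c_def
    by (simp add: prod_sum_PiE assms power_mult_distrib prod.distrib prod_dividef power_sum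
        sum_distrib_right exp_sum sum_negf[symmetric] mult.assoc)
  then have "(\<lambda>t. erlang_density k r t * (\<Prod>i\<in>I. erlang_tail (n i) (u i) t))
      = (\<lambda>t. \<Sum>g\<in>PiE I (\<lambda>i. {..<n i}).
           c g * (erlang_density k r t * (t ^ sum g I * exp (- (sum u I * t)))))"
    by (simp add: sum_distrib_left mult_ac)
  moreover have "has_bochner_integral lborel \<dots> (\<Sum>g\<in>PiE I (\<lambda>i. {..<n i}).
      c g * (fact (k + sum g I) / fact k * r ^ Suc k / (r + sum u I) ^ Suc (k + sum g I)))"
    using assms
    by (intro has_bochner_integral_sum has_bochner_integral_mult_right
        has_bochner_integral_erlang_power_exp sum_nonneg) auto
  moreover have "\<dots> = (\<Sum>g\<in>PiE I (\<lambda>i. {..<n i}).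
      fact (k + sum g I) / (fact k * (\<Prod>i\<in>I. fact (g i)))
              * r ^ Suc k * (\<Prod>i\<in>I. u i ^ g i) / (r + sum u I) ^ Suc (k + sum g I))"
    by (simp add: c_def prod_dividef mult_ac)
  ultimately show ?thesis by simp
qed

section \<open>Analytic properties of Erlang survival functions\<close>

text \<open>Each new summand contributes a difference of two consecutive densities, so the
  derivative telescopes.\<close>

lemma has_real_derivative_erlang_tail:
  assumes "0 \<le> t"
  shows "(erlang_tail (Suc n) l has_real_derivative - erlang_density n l t) (at t)"
proof (induction n)
  case 0
  show ?case unfolding erlang_tail_def using assms
    by (auto intro!: derivative_eq_intros simp: erlang_density_def)
next
  case (Suc n)
  have "((\<lambda>t. (l * t) ^ Suc n / fact (Suc n) * exp (- (l * t))) has_real_derivative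
      real (Suc n) * (l * t) ^ n * l / fact (Suc n) * exp (- (l * t))
        + (l * t) ^ Suc n / fact (Suc n) * (exp (- (l * t)) * - l)) (at t)"
    by (auto intro!: derivative_eq_intros simp: diff_divide_distrib mult_ac
        simp del: fact_Suc power_Suc of_nat_Suc)
  moreover have "real (Suc n) * (l * t) ^ n * l / fact (Suc n) = l * (l * t) ^ n / fact n"
    by (simp del: of_nat_Suc)
  moreover have "erlang_density i l t = l * (l * t) ^ i / fact i * exp (- (l * t))" for i
    using assms by (simp add: erlang_density_def power_mult_distrib)
  ultimately have "((\<lambda>t. (l * t) ^ Suc n / fact (Suc n) * exp (- (l * t))) has_real_derivative
      erlang_density n l t - erlang_density (Suc n) l t) (at t)"
    by (simp only:) (simp add: mult_ac del: fact_Suc power_Suc of_nat_Suc)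
  from DERIV_add[OF Suc.IH this]
  show ?case by (simp add: erlang_tail_def[abs_def] del: fact_Suc power_Suc)
qed

lemma erlang_tail_pos: "0 \<le> l \<Longrightarrow> 0 \<le> t \<Longrightarrow> 0 < erlang_tail (Suc n) l t"
  unfolding erlang_tail_def
  by (rule sum_pos2[where i = 0]) auto

lemma erlang_tail_0 [simp]: "erlang_tail (Suc n) l 0 = 1"
  by (induction n) (auto simp: erlang_tail_def)

lemma erlang_tail_antimono:
  assumes "0 \<le> l" "0 \<le> s" "s \<le> t"
  shows "erlang_tail (Suc n) l t \<le> erlang_tail (Suc n) l s"
proof (rule DERIV_nonpos_imp_nonincreasing[OF assms(3)])
  fix x assume "s \<le> x" "x \<le> t"
  then show "\<exists>y. (erlang_tail (Suc n) l has_real_derivative y) (at x) \<and> y \<le> 0"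
    using assms has_real_derivative_erlang_tail[of x n l] erlang_density_nonneg[of l n x]
    by (intro exI[of _ "- erlang_density n l x"]) simp
qed

lemma tendsto_erlang_tail_at_top:
  assumes "0 < l"
  shows "(erlang_tail n l \<longlongrightarrow> 0) at_top"
proof -
  have "filterlim (\<lambda>t. l * t) at_top at_top"
    using assms by (intro filterlim_tendsto_pos_mult_at_top[OF tendsto_const]) (auto simp: filterlim_ident)
  then have "((\<lambda>t. (l * t) ^ j / exp (l * t)) \<longlongrightarrow> 0) at_top" for j
    by (rule filterlim_compose[OF tendsto_power_div_exp_0])
  then have "((\<lambda>t. \<Sum>j<n. ((l * t) ^ j / exp (l * t)) / fact j) \<longlongrightarrow> (\<Sum>j<n. 0 / fact j)) at_top"
    by (intro tendsto_intros) auto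
  then show ?thesis by (simp add: erlang_tail_def[abs_def] exp_minus field_simps)
qed

section \<open>Functions with a single sign change\<close>

lemma mult_exp_minus_mono:
  fixes s t :: real
  assumes "s \<le> t" "t \<le> 1"
  shows "s * exp (- s) \<le> t * exp (- t)"
proof (rule DERIV_nonneg_imp_nondecreasing[OF assms(1)])
  fix x assume "s \<le> x" "x \<le> t"
  then show "\<exists>y. ((\<lambda>x. x * exp (- x)) has_real_derivative y) (at x) \<and> 0 \<le> y"
    using assms by (intro exI[of _ "(1 - x) * exp (- x)"])
      (auto intro!: derivative_eq_intros simp: algebra_simps)
qed

lemma mult_exp_minus_antimono:
  fixes s t :: real
  assumes "1 \<le> s" "s \<le> t"
  shows "t * exp (- t) \<le> s * exp (- s)"
proof (rule DERIV_nonpos_imp_nonincreasing[OF assms(2)])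
  fix x assume "s \<le> x" "x \<le> t"
  then show "\<exists>y. ((\<lambda>x. x * exp (- x)) has_real_derivative y) (at x) \<and> y \<le> 0"
    using assms by (intro exI[of _ "(1 - x) * exp (- x)"])
      (auto intro!: derivative_eq_intros mult_nonpos_nonneg simp: algebra_simps)
qed

text \<open>The factor \<open>c * (t * exp (- t))\<close> rises until 1 and then decays to 0, so
  \<open>D\<close> first increases from 0, then decreases, then increases towards its limit 0. The
  change of sign must lie on the middle stretch.\<close>

lemma single_crossing:
  fixes D A :: "real \<Rightarrow> real"
  assumes D: "\<And>t. 0 \<le> t \<Longrightarrow> (D has_real_derivative A t * (1 - c * (t * exp (- t)))) (at t)"
    and A: "\<And>t. 0 \<le> t \<Longrightarrow> 0 \<le> A t"
    and D0: "D 0 = 0" and lim: "(D \<longlongrightarrow> 0) at_top"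
    and c: "exp 1 \<le> c"
  obtains t0 where "0 \<le> t0" "\<And>t. 0 \<le> t \<Longrightarrow> t \<le> t0 \<Longrightarrow> 0 \<le> D t" "\<And>t. t0 \<le> t \<Longrightarrow> D t \<le> 0"
proof -
  define g where "g = (\<lambda>t::real. c * (t * exp (- t)))"
  have c0: "0 < c" using c by (rule less_le_trans[rotated]) simp
  \<comment> \<open>The hypothesis on \<open>c\<close> lifts the peak of \<open>g\<close> to at
    least 1; this yields solutions \<open>a\<close> and \<open>b\<close> of \<open>g = 1\<close> on
    either side of the peak.\<close>
  have g1: "1 \<le> g 1" using c c0 by (simp add: g_def exp_minus field_simps)
  have cont: "continuous_on S g" for S unfolding g_def by (intro continuous_intros)
  have "\<exists>a\<ge>0. a \<le> 1 \<and> g a = 1"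
    using g1 cont by (intro IVT') (auto simp: g_def)
  then obtain a where a: "0 \<le> a" "a \<le> 1" "g a = 1" by blast
  have "((\<lambda>t::real. t ^ 1 / exp t) \<longlongrightarrow> 0) at_top" by (rule tendsto_power_div_exp_0)
  then have "(g \<longlongrightarrow> c * 0) at_top"
    unfolding g_def by (intro tendsto_intros) (simp add: exp_minus field_simps)
  then have "eventually (\<lambda>t. g t < 1) at_top" by (intro order_tendstoD) auto
  then have "eventually (\<lambda>t. g t < 1 \<and> 1 \<le> t) at_top"
    using eventually_ge_at_top by (rule eventually_conj)
  then obtain B where B: "g B < 1" "1 \<le> B"
    by (auto dest: eventually_happens)
  have "\<exists>b\<ge>1. b \<le> B \<and> g b = 1"
    using B g1 cont by (intro IVT2') auto
  then obtain b where b: "1 \<le> b" "g b = 1" by blast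
  have g_mono: "g s \<le> g t" if "s \<le> t" "t \<le> 1" for s t
    using mult_exp_minus_mono[OF that] c0 by (simp add: g_def)
  have g_antimono: "g t \<le> g s" if "1 \<le> s" "s \<le> t" for s t
    using mult_exp_minus_antimono[OF that] c0 by (simp add: g_def)
  have D': "(D has_real_derivative A t * (1 - g t)) (at t)" if "0 \<le> t" for t
    using D[OF that] by (simp add: g_def)
  have up: "D s \<le> D t" if "0 \<le> s" "s \<le> t" "\<And>x. s \<le> x \<Longrightarrow> x \<le> t \<Longrightarrow> g x \<le> 1" for s t
  proof (rule DERIV_nonneg_imp_nondecreasing[OF that(2)])
    fix x assume "s \<le> x" "x \<le> t"
    then show "\<exists>y. (D has_real_derivative y) (at x) \<and> 0 \<le> y"
      using D'[of x] A[of x] that by (intro exI[of _ "A x * (1 - g x)"]) auto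
  qed
  have down: "D t \<le> D s" if "0 \<le> s" "s \<le> t" "\<And>x. s \<le> x \<Longrightarrow> x \<le> t \<Longrightarrow> 1 \<le> g x" for s t
  proof (rule DERIV_nonpos_imp_nonincreasing[OF that(2)])
    fix x assume "s \<le> x" "x \<le> t"
    then show "\<exists>y. (D has_real_derivative y) (at x) \<and> y \<le> 0"
      using D'[of x] A[of x] that by (intro exI[of _ "A x * (1 - g x)"]) (auto intro!: mult_nonneg_nonpos)
  qed
  have D1: "0 \<le> D t" if "0 \<le> t" "t \<le> a" for t
    using up[of 0 t] g_mono[of _ a] that a D0 by fastforce
  have D2: "D t \<le> D s" if "a \<le> s" "s \<le> t" "t \<le> b" for s t
  proof (rule down)
    fix x assume "s \<le> x" "x \<le> t"
    then show "1 \<le> g x"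
      using g_mono[of a x] g_antimono[of x b] that a b by (cases "x \<le> 1") auto
  qed (use that a in auto)
  \<comment> \<open>Beyond \<open>b\<close> the function \<open>D\<close> increases to its limit 0,
    so it stays below it.\<close>
  have D3: "D t \<le> 0" if "b \<le> t" for t
  proof (rule tendsto_lowerbound[OF lim])
    show "eventually (\<lambda>s. D t \<le> D s) at_top"
      using eventually_ge_at_top[of t]
    proof eventually_elim
      case (elim s)
      then show ?case
        using g_antimono[of b] that b by (intro up) fastforce+
    qed
  qed simp
  have "isCont D t" if "t \<in> {a..b}" for t
    using a that by (intro DERIV_isCont[OF D']) simp
  then have "continuous_on {a..b} D"
    by (simp add: continuous_at_imp_continuous_on)
  \<comment> \<open>As \<open>D\<close> is nonincreasing between \<open>a\<close> and
    \<open>b\<close>, any zero there separates the signs.\<close>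
  then have "\<exists>t0\<ge>a. t0 \<le> b \<and> D t0 = 0"
    using a b D1[of a] D3[of b] by (intro IVT2') auto
  then obtain t0 where t0: "a \<le> t0" "t0 \<le> b" "D t0 = 0" by blast
  show thesis
  proof
    show "0 \<le> t0" using a t0 by simp
    show "0 \<le> D t" if "0 \<le> t" "t \<le> t0" for t
      using D1[of t] D2[of t t0] t0 that by (cases "t \<le> a") auto
    show "D t \<le> 0" if "t0 \<le> t" for t
      using D3[of t] D2[of t0 t] t0 that by (cases "b \<le> t") auto
  qed
qed

section \<open>The race of two players\<close>

text \<open>For positive \<open>r\<close> and nonnegative \<open>u\<close>, the probability that
  \<open>Suc k\<close> steps at rate \<open>r\<close> are completed before \<open>n\<close> steps at
  rate \<open>u\<close>: a partial sum of negative binomial masses with success probability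
  \<open>r / (r + u)\<close>.\<close>

definition erlang_race :: "nat \<Rightarrow> real \<Rightarrow> nat \<Rightarrow> real \<Rightarrow> real" where
  "erlang_race k r n u =
     (\<Sum>j<n. fact (k + j) / (fact k * fact j) * r ^ Suc k * u ^ j / (r + u) ^ Suc (k + j))"

lemma has_bochner_integral_erlang_tail:
  assumes "0 < r" "0 \<le> u"
  shows "has_bochner_integral lborel (\<lambda>t. erlang_density k r t * erlang_tail n u t)
           (erlang_race k r n u)"
proof -
  have "(\<lambda>t. erlang_density k r t * erlang_tail n u t)
      = (\<lambda>t. \<Sum>j<n. u ^ j / fact j * (erlang_density k r t * (t ^ j * exp (- (u * t)))))"
    by (simp add: erlang_tail_def sum_distrib_left power_mult_distrib mult_ac)
  moreover have "has_bochner_integral lborel \<dots>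
      (\<Sum>j<n. u ^ j / fact j * (fact (k + j) / fact k * r ^ Suc k / (r + u) ^ Suc (k + j)))"
    using assms by (intro has_bochner_integral_sum has_bochner_integral_mult_right
        has_bochner_integral_erlang_power_exp) auto
  moreover have "\<dots> = erlang_race k r n u"
    by (simp add: erlang_race_def mult_ac)
  ultimately show ?thesis by simp
qed

lemma has_real_derivative_erlang_race:
  assumes "0 < r" "0 \<le> u"
  shows "(erlang_race k r (Suc n) has_real_derivative
     - (fact (Suc (k + n)) / (fact k * fact n) * r ^ Suc k * u ^ n
          / (r + u) ^ Suc (Suc (k + n)))) (at u)"
proof (induction n)
  case 0
  have "r + u \<noteq> 0" using assms by auto
  then show ?case unfolding erlang_race_def
    by (auto intro!: derivative_eq_intros simp: divide_simps simp del: power_Suc)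
       (simp add: power2_eq_square algebra_simps)
next
  case (Suc n)
  have ru: "r + u \<noteq> 0" using assms by auto
  define C where "C = fact (Suc (k + n)) / (fact k * fact (Suc n)) * r ^ Suc k"
  define p where "p = (r + u) ^ Suc (k + n)"
  have p: "p \<noteq> 0" using ru by (simp add: p_def)
  have 1: "((\<lambda>u. C * (u ^ Suc n / (r + u) ^ Suc (Suc (k + n)))) has_real_derivative
     C * ((real (Suc n) * u ^ n * (r + u) ^ Suc (Suc (k + n))
         - u ^ Suc n * (real (Suc (Suc (k + n))) * (r + u) ^ Suc (k + n)))
       / ((r + u) ^ Suc (Suc (k + n)) * (r + u) ^ Suc (Suc (k + n))))) (at u)" (is "(_ has_real_derivative C * ?d) _")
    using ru
    by (intro DERIV_cmult DERIV_divide) (auto intro!: derivative_eq_intros simp del: power_Suc of_nat_Suc)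
  have 2: "?d = real (Suc n) * u ^ n / (r + u) ^ Suc (Suc (k + n))
     - real (Suc (Suc (k + n))) * u ^ Suc n / (r + u) ^ Suc (Suc (Suc (k + n)))"
    using ru p unfolding power_Suc[of "r + u" "Suc (k + n)"]
      power_Suc[of "r + u" "Suc (Suc (k + n))"] p_def[symmetric]
    by (simp add: divide_simps del: of_nat_Suc power_Suc) (simp add: algebra_simps)
  \<comment> \<open>By \<open>3\<close> the first part of \<open>?d\<close> cancels the induction
    hypothesis; by \<open>4\<close> the second part is the closed form for
    \<open>Suc n\<close>.\<close>
  have 3: "C * real (Suc n) = fact (Suc (k + n)) / (fact k * fact n) * r ^ Suc k"
    unfolding C_def fact_Suc[of n] of_nat_mult by (simp del: fact_Suc of_nat_Suc)
  have 4: "C * real (Suc (Suc (k + n))) = fact (Suc (k + Suc n)) / (fact k * fact (Suc n)) * r ^ Suc k"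
    unfolding C_def add_Suc_right fact_Suc[of "Suc (k + n)"] of_nat_mult
    by (simp add: mult_ac del: fact_Suc of_nat_Suc)
  have "(\<lambda>u. erlang_race k r (Suc n) u + C * (u ^ Suc n / (r + u) ^ Suc (Suc (k + n))))
      = erlang_race k r (Suc (Suc n))"
    by (rule ext) (simp add: erlang_race_def C_def mult_ac del: fact_Suc power_Suc)
  moreover have "- (fact (Suc (k + n)) / (fact k * fact n) * r ^ Suc k * u ^ n
        / (r + u) ^ Suc (Suc (k + n))) + C * ?d
     = - (fact (Suc (k + Suc n)) / (fact k * fact (Suc n)) * r ^ Suc k * u ^ Suc n
        / (r + u) ^ Suc (Suc (k + Suc n)))"
    unfolding 2 3[symmetric] 4[symmetric]
    by (simp add: right_diff_distrib del: fact_Suc of_nat_Suc power_Suc)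
  ultimately show ?case
    using DERIV_add[OF Suc.IH 1] by (simp del: fact_Suc power_Suc of_nat_Suc)
qed

text \<open>The logarithmic derivative \<open>p / u - q / (r + u)\<close> is negative for
  \<open>u\<close> from \<open>p\<close> on, because \<open>q - p\<close> exceeds
  \<open>r\<close>.\<close>

lemma power_ratio_strict_antimono:
  fixes z r :: real
  assumes "0 < p" "real p < z" "0 < r" "r + real p < real q"
  shows "z ^ p / (r + z) ^ q < real p ^ p / (r + real p) ^ q"
proof -
  define a b where "a = real p" and "b = real q"
  have a: "0 < a" "a < z" "r + a < b" using assms by (simp_all add: a_def b_def)
  define f where "f = (\<lambda>u. a * ln u - b * ln (r + u))"
  have "f z < f a"
  proof (rule DERIV_neg_imp_decreasing[OF a(2)])
    fix u assume u: "a \<le> u" "u \<le> z"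
    have "r * a < (b - a) * a" using a by simp
    also have "\<dots> \<le> (b - a) * u" using u a assms by (intro mult_left_mono) auto
    finally have "a * (r + u) < b * u" by (simp add: algebra_simps)
    then have "a / u < b / (r + u)"
      using u a assms(3) by (simp add: divide_less_eq less_divide_eq mult.commute)
    then show "\<exists>y. (f has_real_derivative y) (at u) \<and> y < 0"
      unfolding f_def using u a assms
      by (intro exI[of _ "a / u - b / (r + u)"]) (auto intro!: derivative_eq_intros)
  qed
  moreover have "ln (u ^ p / (r + u) ^ q) = f u" if "0 < u" for u
    using that assms by (simp add: f_def a_def b_def ln_div ln_realpow)
  ultimately have "ln (z ^ p / (r + z) ^ q) < ln (a ^ p / (r + a) ^ q)"
    using a by (simp add: a_def)
  then show ?thesis
    using assms by (subst (asm) ln_less_cancel_iff) (auto simp: a_def)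
qed

text \<open>The extra step is granted first, at the old rate, and the rate is raised afterwards.
  Gain and loss are the same expression, evaluated at \<open>n\<close> and at an intermediate point
  \<open>z > n\<close>.\<close>

lemma erlang_race_strict_mono:
  fixes k n :: nat
  assumes "n \<ge> 1"
  defines "r \<equiv> real (Suc k)"
  shows "erlang_race k r n (real n) < erlang_race k r (Suc n) (real (Suc n))"
proof -
  define C where "C = fact (Suc (k + n)) / (fact k * fact n) * r ^ Suc k"
  have r: "0 < r" by (simp add: r_def)
  then have C: "0 < C" by (simp add: C_def del: fact_Suc)
  \<comment> \<open>With mean finishing time 1 the quotient \<open>Suc (k + n) / (r + n)\<close> is
    1, so the added summand can be given the constant and exponent of the derivative.\<close>
  have rn: "r + real n = real (Suc (k + n))" by (simp add: r_def)
  have "\<exists>z>real n. z < real (Suc n) \<and>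
     erlang_race k r (Suc n) (real (Suc n)) - erlang_race k r (Suc n) (real n)
       = (real (Suc n) - real n) * - (fact (Suc (k + n)) / (fact k * fact n) * r ^ Suc k * z ^ n
           / (r + z) ^ Suc (Suc (k + n)))"
    using r by (intro MVT2 has_real_derivative_erlang_race) auto
  then obtain z where z: "real n < z"
    and "erlang_race k r (Suc n) (real (Suc n)) - erlang_race k r (Suc n) (real n)
      = - (C * (z ^ n / (r + z) ^ Suc (Suc (k + n))))"
    unfolding C_def by auto
  moreover have "erlang_race k r (Suc n) (real n) - erlang_race k r n (real n)
      = C * (real n ^ n / (r + real n) ^ Suc (Suc (k + n)))"
    unfolding erlang_race_def C_def rn fact_Suc[of "k + n"] of_nat_mult
    by (simp del: of_nat_Suc fact_Suc)
  \<comment> \<open>The exponent \<open>k + n + 2\<close> exceeds \<open>r + n\<close> by exactly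
    1.\<close>
  moreover have "z ^ n / (r + z) ^ Suc (Suc (k + n)) < real n ^ n / (r + real n) ^ Suc (Suc (k + n))"
    using z r assms by (intro power_ratio_strict_antimono) (auto simp: r_def)
  ultimately show ?thesis
    using mult_strict_left_mono[OF _ C] by fastforce
qed

section \<open>Crossing of consecutive survival functions\<close>

text \<open>This is the condition on \<open>c\<close> in \<open>single_crossing\<close>; it comes
  from \<open>1 - x \<le> exp (- x)\<close> at \<open>x = 1 / (n + 1)\<close>.\<close>

lemma exp_1_le_power:
  assumes "n \<ge> 1"
  shows "exp 1 \<le> (real (Suc n) / real n) ^ Suc n"
proof -
  have "1 - 1 / real (Suc n) \<le> exp (- (1 / real (Suc n)))"
    using exp_ge_add_one_self[of "- (1 / real (Suc n))"] by simp
  then have "exp (1 / real (Suc n)) \<le> real (Suc n) / real n"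
    using assms by (simp add: exp_minus field_simps)
  then have "exp (1 / real (Suc n)) ^ Suc n \<le> (real (Suc n) / real n) ^ Suc n"
    by (intro power_mono) auto
  then show ?thesis
    by (simp add: exp_of_nat_mult[symmetric] del: power_Suc of_nat_Suc)
qed

text \<open>The derivative of the difference is a difference of two Erlang densities, whose quotient
  is \<open>c * (t * exp (- t))\<close>.\<close>

lemma erlang_tail_diff_single_crossing:
  assumes "n \<ge> 1"
  obtains t0 where "0 \<le> t0"
    "\<And>t. 0 \<le> t \<Longrightarrow> t \<le> t0 \<Longrightarrow> erlang_tail n (real n) t \<le> erlang_tail (Suc n) (real (Suc n)) t"
    "\<And>t. t0 \<le> t \<Longrightarrow> erlang_tail (Suc n) (real (Suc n)) t \<le> erlang_tail n (real n) t"
proof -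
  obtain q where q: "n = Suc q" using assms by (cases n) auto
  define D where "D = (\<lambda>t. erlang_tail (Suc n) (real (Suc n)) t - erlang_tail n (real n) t)"
  define c where "c = (real (Suc n) / real n) ^ Suc n"
  have density: "erlang_density n (real (Suc n)) t
      = erlang_density q (real n) t * (c * (t * exp (- t)))" if "0 \<le> t" for t
  proof -
    have "c = real (Suc n) ^ Suc n / (real n ^ n * real n)"
      by (simp add: c_def power_divide mult.commute del: of_nat_Suc)
    moreover have "fact n = real n * fact q" by (simp add: q)
    moreover have "exp (- real (Suc n) * t) = exp (- real n * t) * exp (- t)"
      by (simp add: exp_add[symmetric] algebra_simps)
    moreover have "t ^ n = t ^ q * t" by (simp add: q)
    moreover have "real n ^ n \<noteq> 0" "real n \<noteq> 0" using assms by auto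
    ultimately show ?thesis
      using that by (simp add: erlang_density_def q[symmetric] mult_ac del: of_nat_Suc power_Suc)
  qed
  show thesis
  proof (rule single_crossing)
    show "(D has_real_derivative erlang_density q (real n) t * (1 - c * (t * exp (- t)))) (at t)"
      if "0 \<le> t" for t
    proof -
      have "(D has_real_derivative - erlang_density n (real (Suc n)) t - - erlang_density q (real n) t)
          (at t)"
        unfolding D_def q using that by (intro DERIV_diff has_real_derivative_erlang_tail)
      then show ?thesis by (simp add: density[OF that] right_diff_distrib del: of_nat_Suc)
    qed
    show "D 0 = 0" by (simp add: D_def q)
    have "(D \<longlongrightarrow> 0 - 0) at_top"
      unfolding D_def using assms by (intro tendsto_diff tendsto_erlang_tail_at_top) auto
    then show "(D \<longlongrightarrow> 0) at_top" by simp
    show "exp 1 \<le> c" unfolding c_def by (rule exp_1_le_power[OF assms])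
  qed (use that in \<open>auto simp: D_def\<close>)
qed

section \<open>Reduction to two players\<close>

text \<open>Pointwise \<open>D t * h t\<close> is at least \<open>D t * h t0\<close> for
  \<open>t \<ge> 0\<close>: before \<open>t0\<close> both \<open>D\<close> and
  \<open>h t - h t0\<close> are nonnegative, afterwards both are nonpositive.\<close>

lemma integral_erlang_tail_prod_less:
  fixes N :: "'i \<Rightarrow> nat" and k :: nat
  assumes "finite I" "n \<ge> 1" "\<And>i. i \<in> I \<Longrightarrow> N i \<ge> 1"
  defines "h \<equiv> \<lambda>t. \<Prod>i\<in>I. erlang_tail (N i) (real (N i)) t"
    and "f \<equiv> erlang_density k (real (Suc k))"
  assumes int: "integrable lborel (\<lambda>t. f t * (erlang_tail n (real n) t * h t))"
    "integrable lborel (\<lambda>t. f t * (erlang_tail (Suc n) (real (Suc n)) t * h t))"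
  shows "(LINT t|lborel. f t * (erlang_tail n (real n) t * h t))
       < (LINT t|lborel. f t * (erlang_tail (Suc n) (real (Suc n)) t * h t))"
proof -
  define D where "D = (\<lambda>t. erlang_tail (Suc n) (real (Suc n)) t - erlang_tail n (real n) t)"
  obtain t0 where t0: "0 \<le> t0" and D_nonneg: "\<And>t. 0 \<le> t \<Longrightarrow> t \<le> t0 \<Longrightarrow> 0 \<le> D t"
    and D_nonpos: "\<And>t. t0 \<le> t \<Longrightarrow> D t \<le> 0"
    using erlang_tail_diff_single_crossing[OF assms(2)] by (auto simp: D_def)
  have tail_pos: "0 < erlang_tail (N i) (real (N i)) t" if "i \<in> I" "0 \<le> t" for i t
    using assms(3)[OF that(1)] erlang_tail_pos[of "real (N i)" t "N i - 1"] that by simp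
  have h_antimono: "h t \<le> h s" if "0 \<le> s" "s \<le> t" for s t
    unfolding h_def
  proof (rule prod_mono)
    fix i assume i: "i \<in> I"
    then show "0 \<le> erlang_tail (N i) (real (N i)) t \<and>
        erlang_tail (N i) (real (N i)) t \<le> erlang_tail (N i) (real (N i)) s"
      using tail_pos[of i t] erlang_tail_antimono[of "real (N i)" s t "N i - 1"] assms(3)[OF i] that
      by auto
  qed
  \<comment> \<open>Positivity here carries the strict two-player inequality over to the
    product.\<close>
  have pos: "0 < h t0" unfolding h_def using tail_pos t0 by (intro prod_pos) auto
  have has: "has_bochner_integral lborel (\<lambda>t. f t * D t)
      (erlang_race k (real (Suc k)) (Suc n) (real (Suc n)) - erlang_race k (real (Suc k)) n (real n))"
    unfolding D_def f_def right_diff_distrib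
    by (intro has_bochner_integral_diff has_bochner_integral_erlang_tail) auto
  have int_D: "integrable lborel (\<lambda>t. f t * D t * h t)"
    using Bochner_Integration.integrable_diff[OF int(2) int(1)]
    by (simp add: D_def algebra_simps)
  have "0 < h t0 * (LINT t|lborel. f t * D t)"
    using pos erlang_race_strict_mono[OF assms(2)] has_bochner_integral_integral_eq[OF has] by simp
  also have "\<dots> = (LINT t|lborel. f t * D t * h t0)"
    by (simp add: mult.commute)
  also have "\<dots> \<le> (LINT t|lborel. f t * D t * h t)"
  proof (intro integral_mono int_D)
    show "integrable lborel (\<lambda>t. f t * D t * h t0)"
      using has by (auto simp: has_bochner_integral_iff)
    fix t
    show "f t * D t * h t0 \<le> f t * D t * h t"
    proof (cases "0 \<le> t")
      case True
      have f: "0 \<le> f t" by (simp add: f_def)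
      show ?thesis
      proof (cases "t \<le> t0")
        case le: True
        then show ?thesis
          using f D_nonneg[OF True le] h_antimono[OF True le] by (intro mult_left_mono) auto
      next
        case False
        then show ?thesis
          using f D_nonpos[of t] h_antimono[of t0 t] t0
          by (intro mult_left_mono_neg mult_nonneg_nonpos) auto
      qed
    qed (simp add: f_def erlang_density_def)
  qed
  also have "\<dots> = (LINT t|lborel. f t * (erlang_tail (Suc n) (real (Suc n)) t * h t))
      - (LINT t|lborel. f t * (erlang_tail n (real n) t * h t))"
    by (subst Bochner_Integration.integral_diff[OF int(2) int(1), symmetric])
       (simp add: D_def algebra_simps)
  finally show ?thesis by simp
qed

section \<open>Winning probabilities as integrals\<close>

lemma prob_negative_multinomial_le:
  fixes p :: "nat \<Rightarrow> real"
  assumes "finite I" "r \<ge> 1" "\<And>l. l \<in> I \<Longrightarrow> 0 < p l" "sum p I < 1"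
    and "\<And>l. l \<in> I \<Longrightarrow> n l \<ge> 1"
  shows "measure_pmf.prob (negative_multinomial_pmf I r p) {A. \<forall>l\<in>I. A l \<le> n l - 1}
       = (\<Sum>g\<in>PiE I (\<lambda>l. {..<n l}). negative_multinomial_mass I r p g)"
proof -
  let ?M = "negative_multinomial_pmf I r p"
  \<comment> \<open>Functions in \<open>PiE\<close> are \<open>undefined\<close> outside
    \<open>I\<close>, count vectors are 0 there; \<open>?z\<close> translates. The mass only reads
    entries in \<open>I\<close>.\<close>
  let ?z = "\<lambda>g l. if l \<in> I then g l else 0"
  have box: "PiE_dflt I 0 (\<lambda>l. {..<n l}) = {A. \<forall>l\<in>I. A l \<le> n l - 1} \<inter> count_vectors I"
    using assms(5) by (fastforce simp: PiE_dflt_def count_vectors_def)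
  have fin: "finite (PiE_dflt I 0 (\<lambda>l. {..<n l}))"
    using assms(1) by auto
  have inj: "inj_on ?z (PiE I (\<lambda>l. {..<n l}))"
    by (rule inj_onI, rule ext) (metis PiE_arb)
  have "measure_pmf.prob ?M {A. \<forall>l\<in>I. A l \<le> n l - 1}
      = measure_pmf.prob ?M (PiE_dflt I 0 (\<lambda>l. {..<n l}))"
    unfolding box by (rule measure_prob_cong_0) (auto simp: pmf_negative_multinomial[OF assms(1-4)])
  also have "\<dots> = (\<Sum>A\<in>PiE_dflt I 0 (\<lambda>l. {..<n l}). negative_multinomial_mass I r p A)"
    unfolding measure_measure_pmf_finite[OF fin]
    by (intro sum.cong) (auto simp: pmf_negative_multinomial[OF assms(1-4)] box)
  also have "\<dots> = (\<Sum>g\<in>PiE I (\<lambda>l. {..<n l}). negative_multinomial_mass I r p (?z g))"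
    unfolding dflt_image_PiE[symmetric] by (subst sum.reindex[OF inj]) simp
  also have "\<dots> = (\<Sum>g\<in>PiE I (\<lambda>l. {..<n l}). negative_multinomial_mass I r p g)"
    by (simp add: negative_multinomial_mass_def)
  finally show ?thesis .
qed

text \<open>Normalising the rates \<open>n l\<close> by their total \<open>S\<close> gives the step
  probabilities, and the leftover mass is that of player 1. The powers of \<open>S\<close> then
  collect to the denominator of the integrated product.\<close>

lemma win_prob_has_bochner_integral:
  assumes "m \<ge> 1" "\<And>l. l \<in> {1..m} \<Longrightarrow> n l \<ge> 1" "n 1 = Suc k"
  shows "has_bochner_integral lborel
           (\<lambda>t. erlang_density k (real (Suc k)) t * (\<Prod>l\<in>{2..m}. erlang_tail (n l) (real (n l)) t))
           (win_prob m n)"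
proof -
  define S where "S = real (\<Sum>j=1..m. n j)"
  define p where "p = (\<lambda>l. real (n l) / S)"
  have S_eq: "S = real (Suc k) + (\<Sum>l=2..m. real (n l))"
    unfolding S_def using assms(1,3) by (simp add: sum.atLeast_Suc_atMost numeral_2_eq_2)
  have "0 \<le> (\<Sum>l=2..m. real (n l))" by (intro sum_nonneg) auto
  then have S: "0 < S" unfolding S_eq by simp
  have sum_p: "sum p {2..m} = (\<Sum>l=2..m. real (n l)) / S"
    by (simp add: p_def sum_divide_distrib)
  have p1: "1 - sum p {2..m} = real (Suc k) / S"
    unfolding sum_p using S by (simp add: field_simps) (simp add: S_eq)
  have "0 < real (Suc k) / S" using S by simp
  then have sum_p_less: "sum p {2..m} < 1" using p1 by linarith
  have p_pos: "0 < p l" if "l \<in> {2..m}" for l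
    using assms(2)[of l] that S by (simp add: p_def)
  have "negative_multinomial_mass {2..m} (Suc k) p g
     = fact (k + sum g {2..m}) / (fact k * (\<Prod>l\<in>{2..m}. fact (g l)))
         * real (Suc k) ^ Suc k * (\<Prod>l\<in>{2..m}. real (n l) ^ g l)
         / (real (Suc k) + (\<Sum>l=2..m. real (n l))) ^ Suc (k + sum g {2..m})" for g
    unfolding negative_multinomial_mass_def p1 S_eq[symmetric]
    by (simp add: p_def power_divide prod_dividef power_sum[symmetric] power_add
        del: of_nat_Suc)
  moreover have "win_prob m n
      = (\<Sum>g\<in>PiE {2..m} (\<lambda>l. {..<n l}). negative_multinomial_mass {2..m} (Suc k) p g)"
    unfolding win_prob_def assms(3) p_def[symmetric, unfolded S_def]
    using assms(2) by (intro prob_negative_multinomial_le p_pos sum_p_less) auto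
  ultimately show ?thesis
    using has_bochner_integral_erlang_tail_prod[of "{2..m}" "real (Suc k)" "\<lambda>l. real (n l)" k n]
    by (simp del: of_nat_Suc power_Suc)
qed

text \<open>Changing one entry alters every step probability, but in the integral only the factor of
  player \<open>j\<close> changes, since the other rates stay fixed.\<close>

lemma win_prob_less_Suc:
  assumes "j \<in> {2..m}" "\<And>l. l \<in> {1..m} \<Longrightarrow> n l \<ge> 1" "x \<ge> 1"
  shows "win_prob m (n(j := x)) < win_prob m (n(j := Suc x))"
proof -
  define I where "I = {2..m} - {j}"
  define h where "h = (\<lambda>t. \<Prod>l\<in>I. erlang_tail (n l) (real (n l)) t)"
  have "n 1 \<ge> 1" using assms(1,2) by auto
  then obtain k where k: "n 1 = Suc k" by (cases "n 1") auto
  have prod: "(\<Prod>l\<in>{2..m}. erlang_tail ((n(j := y)) l) (real ((n(j := y)) l)) t)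
      = erlang_tail y (real y) t * h t" for y t
  proof -
    have "(\<Prod>l\<in>I. erlang_tail ((n(j := y)) l) (real ((n(j := y)) l)) t) = h t"
      unfolding h_def I_def by (intro prod.cong) auto
    then show ?thesis
      unfolding I_def using assms(1) by (subst prod.remove[of _ j]) auto
  qed
  have win: "has_bochner_integral lborel
      (\<lambda>t. erlang_density k (real (Suc k)) t * (erlang_tail y (real y) t * h t))
      (win_prob m (n(j := y)))" if "y \<ge> 1" for y
    unfolding prod[symmetric] using assms that k
    by (intro win_prob_has_bochner_integral) auto
  have "(LINT t|lborel. erlang_density k (real (Suc k)) t * (erlang_tail x (real x) t * h t))
      < (LINT t|lborel. erlang_density k (real (Suc k)) t * (erlang_tail (Suc x) (real (Suc x)) t * h t))"
    using assms win[of x] win[of "Suc x"] unfolding h_def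
    by (intro integral_erlang_tail_prod_less[where I = I and N = n])
       (auto simp: I_def has_bochner_integral_iff simp del: of_nat_Suc)
  then show ?thesis
    using win[of x] win[of "Suc x"] assms(3) by (simp add: has_bochner_integral_iff)
qed

theorem theorem17:
  fixes m :: nat
  assumes "m \<ge> 2"
  shows "\<forall>n :: nat \<Rightarrow> nat. (\<forall>l\<in>{1..m}. n l \<ge> 1) \<longrightarrow>
           (\<forall>k\<in>{2..m}. strict_mono_on {1..} (\<lambda>x. win_prob m (n(k := x))))"
proof (intro allI impI ballI strict_mono_onI)
  fix n :: "nat \<Rightarrow> nat" and k x y :: nat
  assume n: "\<forall>l\<in>{1..m}. n l \<ge> 1" and k: "k \<in> {2..m}" and "x \<in> {1..}" "y \<in> {1..}" "x < y"
  then have "x \<ge> 1" by simp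
  \<comment> \<open>Shifting by \<open>x\<close> keeps the entry at least 1, so that the step holds
    for every natural \<open>d\<close>.\<close>
  have "win_prob m (n(k := x + d)) < win_prob m (n(k := x + Suc d))" for d
    using win_prob_less_Suc[OF k, of n "x + d"] n \<open>x \<ge> 1\<close> by (simp del: fun_upd_apply)
  from lift_Suc_mono_less[of "\<lambda>d. win_prob m (n(k := x + d))", OF this, of 0 "y - x"]
  show "win_prob m (n(k := x)) < win_prob m (n(k := y))"
    using \<open>x < y\<close> by simp
qed

end
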